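(* Let $(x,y),(x',y'),(x'',y'')\in\mathbb Z_{\ge0}^2$ be three points with $x\ge y$, $x'\ge y'$ and $x''\ge y''$. If $(x',y')=\frac{(x,y)+(x'',y'')}{2}$, then $$m_{x,y}+m_{x'',y''}\ge 2m_{x',y'}.$$
   Context: For $A=(x,y)\in\mathbb Z_{\ge0}^2$ with $y\le x$, $m_{x,y}=|OA|$ is the Markov distance from $O=(0,0)$ to $A$: the number obtained from the element of the once-punctured torus cluster algebra attached to the left deformation of the segment $OA$ by specializing the three initial cluster variables to $1$. Concretely, for coprime $(x,y)$ the number $m_{x,y}$ is the Markov number attached to the Farey fraction $y/x$: $m_{1,0}=m_{0,1}=1$, $m_{1,1}=2$, and whenever $(a,b),(c,d)\in\mathbb Z_{\ge0}^2$ satisfy $|ad-bc|=1$ and $\{(a,b),(c,d)\}\ne\{(1,0),(0,1)\}$, $m_{a+c,b+d}=3m_{a,b}m_{c,d}-m_{|a-c|,|b-d|}$ (e.g. $m_{2,1}=5$, $m_{3,1}=13$, $m_{3,2}=29$). For non-coprime points: if $q,p$ are coprime and $f_n=m_{nq,np}$, then $f_0=0$, $f_1=m_{q,p}$, $f_n=3f_1f_{n-1}-f_{n-2}$ for $n\ge2$; in particular $m_{0,0}=0$. *)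

theory Defs
  imports Complex_Main
begin

text \<open>
  \<open>m x y\<close> stands for \<open>m\<^bsub>x,y\<^esub>\<close>. The recurrence over Farey mediants determines \<open>m\<close> at the
  coprime points and the recurrence over multiples at the others; both are imposed on the whole
  quadrant. That they have exactly one common solution is \<open>ex1_markov_distance\<close> below.
\<close>

definition is_markov_distance :: "(nat \<Rightarrow> nat \<Rightarrow> int) \<Rightarrow> bool" where
  "is_markov_distance m \<longleftrightarrow>
     m 1 0 = 1 \<and> m 0 1 = 1 \<and> m 1 1 = 2 \<and>
     (\<forall>a b c d. \<bar>int a * int d - int b * int c\<bar> = 1 \<longrightarrow> {(a, b), (c, d)} \<noteq> {(1, 0), (0, 1)} \<longrightarrow>
        m (a + c) (b + d) =
          3 * m a b * m c d - m (nat \<bar>int a - int c\<bar>) (nat \<bar>int b - int d\<bar>)) \<and>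
     (\<forall>q p. coprime q p \<longrightarrow>
        m (0 * q) (0 * p) = 0 \<and>
        (\<forall>n\<ge>2. m (n * q) (n * p) =
           3 * m q p * m ((n - 1) * q) ((n - 1) * p) - m ((n - 2) * q) ((n - 2) * p)))"

definition markov_dist :: "nat \<Rightarrow> nat \<Rightarrow> int" where
  "markov_dist = (THE m. is_markov_distance m)"

subsection \<open>The defining recurrences have exactly one solution\<close>

lemma farey_parents_exist:
  assumes "coprime x y" "x \<ge> 1" "y \<ge> 1"
  shows "\<exists>a b c d. x = a + c \<and> y = b + d \<and> a * d = b * c + (1::nat)"
  using assms
proof (induction "x + y" arbitrary: x y rule: less_induct)
  case less
  consider "x = y" | "x > y" | "x < y" by linarith
  then show ?case
  proof cases
    case 1
    then have "x = 1" "y = 1" using less.prems by auto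
    then show ?thesis by (intro exI[of _ 1] exI[of _ 0]) (auto intro!: exI[of _ 0] exI[of _ 1])
  next
    case 2
    then have "coprime (x - y) y" using less.prems
      by (metis coprime_diff_one_left_nat coprime_iff_gcd_eq_1 gcd_diff1_nat less_imp_le_nat)
    moreover have "x - y + y < x + y" "x - y \<ge> 1" using 2 less.prems by simp_all
    ultimately obtain a b c d where *: "x - y = a + c" "y = b + d" "a * d = b * c + 1"
      using less.hyps[of "x - y" y] less.prems(3) by blast
    have "x = (a + b) + (c + d) \<and> y = b + d \<and> (a + b) * d = b * (c + d) + 1"
      using * 2 by (auto simp: algebra_simps)
    then show ?thesis by blast
  next
    case 3
    then have "coprime x (y - x)" using less.prems
      by (metis coprime_commute coprime_iff_gcd_eq_1 gcd_diff1_nat less_imp_le_nat)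
    moreover have "x + (y - x) < x + y" "y - x \<ge> 1" using 3 less.prems by simp_all
    ultimately obtain a b c d where *: "x = a + c" "y - x = b + d" "a * d = b * c + 1"
      using less.hyps[of x "y - x"] less.prems(2) by blast
    have "x = a + c \<and> y = (a + b) + (c + d) \<and> a * (c + d) = (a + b) * c + 1"
      using * 3 by (auto simp: algebra_simps)
    then show ?thesis by blast
  qed
qed

lemma farey_det_coprime:
  assumes "a * d = b * c + (1::nat)"
  shows "coprime (a + c) (b + d)"
proof (rule coprimeI)
  fix k assume k: "k dvd a + c" "k dvd b + d"
  have "a * (b + d) = b * (a + c) + 1" using assms by (simp add: algebra_simps)
  moreover have "k dvd a * (b + d)" "k dvd b * (a + c)" using k by auto
  ultimately show "is_unit k" by (metis dvd_add_right_iff)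
qed

lemma farey_parents_unique:
  assumes "a * d = b * c + (1::nat)" "a' * d' = b' * c' + 1" "a + c = a' + c'" "b + d = b' + d'"
  shows "a = a' \<and> b = b' \<and> c = c' \<and> d = d'"
proof -
  define x y where "x = int a + int c" and "y = int b + int d"
  have x': "x = int a' + int c'" and y': "y = int b' + int d'"
    using assms(3,4) unfolding x_def y_def by (simp_all flip: of_nat_add)
  have i1: "int a * int d = int b * int c + 1" and i2: "int a' * int d' = int b' * int c' + 1"
    using assms(1,2) by (metis of_nat_1 of_nat_add of_nat_mult)+
  have e1: "int a * y - int b * x = 1" using i1 by (simp add: x_def y_def algebra_simps)
  have e2: "int a' * y - int b' * x = 1" using i2 by (simp add: x' y' algebra_simps)
  have e: "(int a - int a') * y = (int b - int b') * x" using e1 e2 by (simp add: algebra_simps)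
  have "coprime x y"
    using farey_det_coprime[OF assms(1)] unfolding x_def y_def
    by (metis coprime_int_iff of_nat_add)
  moreover have "x dvd (int a - int a') * y" using e by simp
  ultimately have dv: "x dvd int a - int a'" using coprime_dvd_mult_left_iff by blast
  have "a \<ge> 1" "a' \<ge> 1" using assms(1,2) by (cases a; cases a'; auto)+
  then have xp: "x > 0" and "\<bar>int a - int a'\<bar> < x" using x_def x' by linarith+
  then have aa: "int a = int a'" using dv
    by (metis dvd_imp_le_int abs_of_pos eq_iff_diff_eq_0 linorder_not_less)
  then have "int b = int b'" using e xp by simp
  then show ?thesis using aa assms(3,4) by simp
qed

lemma farey_diff_less:
  assumes "a * d = b * c + (1::nat)" "a + c + b + d > 2"
  shows "nat \<bar>int a - int c\<bar> + nat \<bar>int b - int d\<bar> < a + c + (b + d)"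
proof -
  have ne: "a \<ge> 1" "d \<ge> 1" using assms(1) by (cases a; cases d; auto)+
  have "\<not> (c = 0 \<and> b = 0)" using assms by auto
  then show ?thesis using ne by linarith
qed

definition farey_parents :: "nat \<Rightarrow> nat \<Rightarrow> nat \<times> nat \<times> nat \<times> nat" where
  "farey_parents x y = (SOME (a, b, c, d). x = a + c \<and> y = b + d \<and> a * d = b * c + 1)"

lemma farey_parentsD:
  assumes "coprime x y" "x \<ge> 1" "y \<ge> 1" "farey_parents x y = (a, b, c, d)"
  shows "x = a + c \<and> y = b + d \<and> a * d = b * c + 1"
proof -
  have "\<exists>t. case t of (a, b, c, d) \<Rightarrow> x = a + c \<and> y = b + d \<and> a * d = b * c + 1"
    using farey_parents_exist[OF assms(1-3)] by auto
  from someI_ex[OF this] show ?thesis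
    using assms(4) unfolding farey_parents_def by simp
qed

lemma farey_parents_eq:
  assumes "a * d = b * c + 1" "a + c \<ge> 1" "b + d \<ge> 1"
  shows "farey_parents (a + c) (b + d) = (a, b, c, d)"
proof -
  obtain a' b' c' d' where e: "farey_parents (a + c) (b + d) = (a', b', c', d')"
    by (metis prod_cases4)
  from farey_parentsD[OF farey_det_coprime[OF assms(1)] assms(2,3) e]
  show ?thesis using farey_parents_unique[OF assms(1)] e by metis
qed

lemma farey_parents_less:
  assumes "coprime x y" "Suc 0 \<le> x" "Suc 0 \<le> y" "2 < x + y"
    and e: "farey_parents x y = (a, b, c, d)"
  shows "a + b < x + y \<and> c + d < x + y
    \<and> nat \<bar>int a - int c\<bar> + nat \<bar>int b - int d\<bar> < x + y"
proof -
  have *: "x = a + c" "y = b + d" "a * d = b * c + 1"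
    using farey_parentsD[OF assms(1) _ _ e] assms(2,3) by auto
  have "a \<ge> 1" "d \<ge> 1" using *(3) by (cases a; cases d; auto)+
  then show ?thesis using * farey_diff_less[OF *(3)] assms(4) by simp
qed

function markov_farey :: "nat \<Rightarrow> nat \<Rightarrow> int" where
  "markov_farey x y =
     (if coprime x y \<and> x \<ge> 1 \<and> y \<ge> 1 \<and> x + y > 2
      then case farey_parents x y of (a, b, c, d) \<Rightarrow>
        3 * markov_farey a b * markov_farey c d
          - markov_farey (nat \<bar>int a - int c\<bar>) (nat \<bar>int b - int d\<bar>)
      else if x = 1 \<and> y = 1 then 2 else 1)"
  by pat_completeness auto
termination
  by (relation "measure (\<lambda>(x, y). x + y)") (auto dest!: farey_parents_less[OF _ _ _ _ sym])

declare markov_farey.simps [simp del]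

fun markov_mult :: "int \<Rightarrow> nat \<Rightarrow> int" where
  "markov_mult t 0 = 0"
| "markov_mult t (Suc 0) = t"
| "markov_mult t (Suc (Suc n)) = 3 * t * markov_mult t (Suc n) - markov_mult t n"

definition markov_sol :: "nat \<Rightarrow> nat \<Rightarrow> int" where
  "markov_sol x y = markov_mult (markov_farey (x div gcd x y) (y div gcd x y)) (gcd x y)"

lemma markov_sol_coprime: "coprime x y \<Longrightarrow> markov_sol x y = markov_farey x y"
  by (simp add: markov_sol_def)

lemma markov_sol_multiple:
  assumes "coprime q p"
  shows "markov_sol (n * q) (n * p) = markov_mult (markov_farey q p) n"
proof (cases "n = 0")
  case True
  then show ?thesis by (simp add: markov_sol_def)
next
  case False
  have "gcd (n * q) (n * p) = n" using assms by (simp add: gcd_mult_distrib_nat[symmetric])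
  then show ?thesis using False by (simp add: markov_sol_def)
qed

lemma markov_det_nat_iff:
  "\<bar>int a * int d - int b * int c\<bar> = 1 \<longleftrightarrow> a * d = b * c + 1 \<or> c * b = d * a + 1"
proof -
  have "\<bar>int (a * d) - int (b * c)\<bar> = 1 \<longleftrightarrow> a * d = b * c + 1 \<or> b * c = a * d + 1" by linarith
  then show ?thesis by (simp add: mult.commute)
qed

lemma markov_det_excluded:
  fixes a b c d :: nat
  assumes "a * d = b * c + 1" "{(a, b), (c, d)} \<noteq> {(1, 0), (0, 1)}"
  shows "a + c + b + d > 2"
proof (rule ccontr)
  assume "\<not> ?thesis"
  moreover have "a \<ge> 1" "d \<ge> 1" using assms(1) by (cases a; cases d; auto)+
  ultimately have "a = 1 \<and> d = 1 \<and> b = 0 \<and> c = 0" by linarith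
  then show False using assms(2) by simp
qed

lemma farey_det_coprime_diff:
  assumes "a * d = b * c + (1::nat)" "a + c + b + d > 2"
  shows "coprime (nat \<bar>int a - int c\<bar>) (nat \<bar>int b - int d\<bar>)"
proof (rule coprimeI)
  fix k assume k: "k dvd nat \<bar>int a - int c\<bar>" "k dvd nat \<bar>int b - int d\<bar>"
  have "int k dvd int a - int c" "int k dvd int b - int d"
    using k by (simp_all only: dvd_nat_abs_iff)
  then have "int k dvd int b * (int a - int c) - int a * (int b - int d)"
    by (meson dvd_diff dvd_mult)
  moreover have "int b * (int a - int c) - int a * (int b - int d) = 1"
    using arg_cong[OF assms(1), of int] by (simp add: algebra_simps)
  ultimately show "is_unit k" by (metis int_dvd_int_iff of_nat_1)
qed

lemma markov_sol_step:
  assumes "a * d = b * c + (1::nat)" "{(a, b), (c, d)} \<noteq> {(1, 0), (0, 1)}"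
  shows "markov_sol (a + c) (b + d) =
    3 * markov_sol a b * markov_sol c d - markov_sol (nat \<bar>int a - int c\<bar>) (nat \<bar>int b - int d\<bar>)"
proof -
  have big: "a + c + b + d > 2" using markov_det_excluded[OF assms] .
  have ne: "a \<ge> 1" "d \<ge> 1" using assms(1) by (cases a; cases d; auto)+
  have cop: "coprime a b" "coprime c d"
  proof -
    show "coprime a b"
    proof (rule coprimeI)
      fix k assume "k dvd a" "k dvd b"
      then have "k dvd b * c + 1" "k dvd b * c" using assms(1) by (metis dvd_mult2)+
      then show "is_unit k" by (metis dvd_add_right_iff)
    qed
    show "coprime c d"
    proof (rule coprimeI)
      fix k assume "k dvd c" "k dvd d"
      then have "k dvd b * c + 1" "k dvd b * c" using assms(1) by (metis dvd_mult)+
      then show "is_unit k" by (metis dvd_add_right_iff)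
    qed
  qed
  have c0: "coprime (a + c) (b + d)" by (rule farey_det_coprime[OF assms(1)])
  have "farey_parents (a + c) (b + d) = (a, b, c, d)"
    using farey_parents_eq[OF assms(1)] ne by simp
  then have "markov_farey (a + c) (b + d) = 3 * markov_farey a b * markov_farey c d
      - markov_farey (nat \<bar>int a - int c\<bar>) (nat \<bar>int b - int d\<bar>)"
    using c0 ne big by (subst markov_farey.simps) simp
  then show ?thesis
    using markov_sol_coprime[OF c0] markov_sol_coprime[OF cop(1)] markov_sol_coprime[OF cop(2)]
      markov_sol_coprime[OF farey_det_coprime_diff[OF assms(1) big]] by simp
qed

lemma is_markov_distance_markov_sol: "is_markov_distance markov_sol"
  unfolding is_markov_distance_def
proof (intro conjI allI impI)
  have "markov_farey 1 0 = 1" "markov_farey 0 1 = 1" "markov_farey 1 1 = 2"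
    by (subst markov_farey.simps, simp)+
  then show "markov_sol 1 0 = 1" "markov_sol 0 1 = 1" "markov_sol 1 1 = 2"
    by (simp_all add: markov_sol_coprime)
next
  fix a b c d :: nat
  assume det: "\<bar>int a * int d - int b * int c\<bar> = 1" and ne: "{(a, b), (c, d)} \<noteq> {(1, 0), (0, 1)}"
  from det[unfolded markov_det_nat_iff] show "markov_sol (a + c) (b + d) = 3 * markov_sol a b * markov_sol c d
      - markov_sol (nat \<bar>int a - int c\<bar>) (nat \<bar>int b - int d\<bar>)"
  proof
    assume "a * d = b * c + 1"
    then show ?thesis using ne by (rule markov_sol_step)
  next
    assume 2: "c * b = d * a + 1"
    have "{(c, d), (a, b)} \<noteq> {(1, 0), (0, 1)}" using ne by (simp add: insert_commute)
    from markov_sol_step[OF 2 this] show ?thesis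
      by (simp add: add.commute abs_minus_commute mult.commute mult.left_commute)
  qed
next
  fix q p :: nat assume "coprime q p"
  then show "markov_sol (0 * q) (0 * p) = 0" by (simp add: markov_sol_def)
next
  fix q p n :: nat assume qp: "coprime q p" and "2 \<le> n"
  then obtain k where "n = Suc (Suc k)" by (metis Suc_le_D numeral_2_eq_2 Suc_le_mono)
  then show "markov_sol (n * q) (n * p) =
     3 * markov_sol q p * markov_sol ((n - 1) * q) ((n - 1) * p)
       - markov_sol ((n - 2) * q) ((n - 2) * p)"
    using markov_sol_multiple[OF qp] markov_sol_coprime[OF qp] by (simp del: mult_Suc)
qed

lemma is_markov_distance_step:
  assumes "is_markov_distance m" "\<bar>int a * int d - int b * int c\<bar> = 1"
    and "{(a, b), (c, d)} \<noteq> {(1, 0), (0, 1)}"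
  shows "m (a + c) (b + d) =
    3 * m a b * m c d - m (nat \<bar>int a - int c\<bar>) (nat \<bar>int b - int d\<bar>)"
  using assms(1)[unfolded is_markov_distance_def, THEN conjunct2, THEN conjunct2, THEN conjunct2,
      THEN conjunct1, rule_format, OF assms(2,3)] .

lemma is_markov_distance_multiple:
  assumes "is_markov_distance m" "coprime q p" "n \<ge> 2"
  shows "m (n * q) (n * p) =
    3 * m q p * m ((n - 1) * q) ((n - 1) * p) - m ((n - 2) * q) ((n - 2) * p)"
  using assms(1)[unfolded is_markov_distance_def, THEN conjunct2, THEN conjunct2, THEN conjunct2,
      THEN conjunct2, THEN spec, THEN spec, THEN mp, OF assms(2), THEN conjunct2, THEN spec,
      THEN mp, OF assms(3)] .

lemma is_markov_distance_0:
  assumes "is_markov_distance m"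
  shows "m 0 0 = 0"
  using assms[unfolded is_markov_distance_def, THEN conjunct2, THEN conjunct2, THEN conjunct2,
      THEN conjunct2, THEN spec, THEN spec, THEN mp, of 1 0] by simp

lemma is_markov_distance_unique:
  assumes m: "is_markov_distance m" and m': "is_markov_distance m'"
  shows "m x y = m' x y"
proof (induction "x + y" arbitrary: x y rule: less_induct)
  case less
  define g where "g = gcd x y"
  consider "g = 0" | "g = 1" | "g \<ge> 2" by linarith
  then show ?case
  proof cases
    case 1
    then show ?thesis using is_markov_distance_0[OF m] is_markov_distance_0[OF m']
      by (simp add: g_def)
  next
    case 2
    then have cop: "coprime x y" by (simp add: g_def coprime_iff_gcd_eq_1)
    consider "x = 0" | "y = 0" | "x = 1 \<and> y = 1" | "x \<ge> 1 \<and> y \<ge> 1 \<and> x + y > 2" by linarith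
    then show ?thesis
    proof cases
      case 1
      then have "y = 1" using cop by simp
      then show ?thesis using 1 m m' unfolding is_markov_distance_def by simp
    next
      case 2
      then have "x = 1" using cop by simp
      then show ?thesis using 2 m m' unfolding is_markov_distance_def by simp
    next
      case 3
      then show ?thesis using m m' unfolding is_markov_distance_def by simp
    next
      case 4
      then obtain a b c d where *: "x = a + c" "y = b + d" "a * d = b * c + 1"
        using farey_parents_exist[OF cop] by blast
      let ?u = "nat \<bar>int a - int c\<bar>" and ?v = "nat \<bar>int b - int d\<bar>"
      have ne: "a \<ge> 1" "d \<ge> 1" using *(3) by (cases a; cases d; auto)+
      have nex: "{(a, b), (c, d)} \<noteq> {(1, 0), (0, 1)}"
      proof
        assume "{(a, b), (c, d)} = {(1, 0), (0, 1)}"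
        then have "a + c + (b + d) = 2" by (auto simp: doubleton_eq_iff)
        then show False using 4 * by simp
      qed
      have det: "\<bar>int a * int d - int b * int c\<bar> = 1"
        unfolding markov_det_nat_iff using *(3) by (rule disjI1)
      have "m x y = 3 * m a b * m c d - m ?u ?v" "m' x y = 3 * m' a b * m' c d - m' ?u ?v"
        unfolding *(1,2)
        by (rule is_markov_distance_step[OF m det nex], rule is_markov_distance_step[OF m' det nex])
      moreover have "m a b = m' a b" "m c d = m' c d" using less.hyps * ne by simp_all
      moreover have "m ?u ?v = m' ?u ?v"
        using less.hyps[of ?u ?v] farey_diff_less[OF *(3)] 4 * by simp
      ultimately show ?thesis by simp
    qed
  next
    case 3
    define q p where "q = x div g" and "p = y div g"
    have xy: "x = g * q" "y = g * p" by (simp_all add: q_def p_def g_def)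
    have cop: "coprime q p" using 3 unfolding q_def p_def g_def
      by (metis div_gcd_coprime gcd_eq_0_iff not_numeral_le_zero)
    then have pos: "q + p > 0" by (cases "q = 0") auto
    have lt: "j * q + j * p < x + y" if "j < g" for j
    proof -
      have "j * (q + p) < g * (q + p)" using that pos by simp
      then show ?thesis by (simp add: xy algebra_simps)
    qed
    have r: "m x y = 3 * m q p * m ((g - 1) * q) ((g - 1) * p) - m ((g - 2) * q) ((g - 2) * p)"
      "m' x y = 3 * m' q p * m' ((g - 1) * q) ((g - 1) * p) - m' ((g - 2) * q) ((g - 2) * p)"
      using is_markov_distance_multiple[OF m cop 3] is_markov_distance_multiple[OF m' cop 3]
      by (simp_all only: xy)
    have "m (j * q) (j * p) = m' (j * q) (j * p)" if "j < g" for j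
      using less.hyps lt[OF that] by blast
    from this[of 1] this[of "g - 1"] this[of "g - 2"] show ?thesis using r 3 by simp
  qed
qed

theorem ex1_markov_distance: "\<exists>!m. is_markov_distance m"
proof (rule ex1I)
  show "is_markov_distance markov_sol" by (rule is_markov_distance_markov_sol)
next
  fix m assume "is_markov_distance m"
  then show "m = markov_sol"
    by (intro ext is_markov_distance_unique is_markov_distance_markov_sol)
qed

theorem is_markov_distance_markov_dist: "is_markov_distance markov_dist"
  unfolding markov_dist_def by (rule theI'[OF ex1_markov_distance])

end

theory Submission
  imports Defs
begin

text \<open>
  Write the midpoint as $hQ$ with $Q$ primitive and let $Q = U + W$ be its Farey decomposition.
  Three times a Markov number is the trace of a matrix in SL(2); let $\theta > 1$ be the eigenvalue
  of the matrix of $Q$, so that $\theta + 1/\theta = 3 m_Q$. In an eigenbasis of that matrix the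
  matrices of $U$, $Q$ and $-W$ have nonnegative entries. Every lattice point $X = kU + jQ$ of the
  quadrant with $k \ge 1$ is represented by a word in two of them, and the product of the upper left
  entries bounds the trace of the word: $3 m_X \ge \alpha^k \theta^j$, with $\alpha$ the upper left
  entry for $U$. The same holds for $kW + iQ$ with some $\alpha'$, and the Markov equation gives
  $\alpha \alpha' = \theta (\theta + 1/\theta)^2 / (\theta - 1/\theta)^2$.
  The two outer points are $kU + jQ$ and $kW + (2h-k-j)Q$, so the product of their Markov distances
  is at least $m_{hQ}^2$, and the arithmetic-geometric mean inequality concludes. If the three
  points lie on a line through the origin, the claim is the convexity of sinh on the positive axis.
\<close>

section \<open>Traces on signed lattice points and their product identity\<close>

text \<open>
  Junk values: $m$ is extended to signed coordinates by absolute values, which is the natural even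
  extension only at the points that satisfy \<open>same_sign\<close>.
\<close>

definition markov_trace :: "int \<Rightarrow> int \<Rightarrow> real" where
  "markov_trace x y = 3 * real_of_int (markov_dist (nat \<bar>x\<bar>) (nat \<bar>y\<bar>))"

definition same_sign :: "int \<Rightarrow> int \<Rightarrow> bool" where
  "same_sign x y \<longleftrightarrow> 0 \<le> x \<and> 0 \<le> y \<or> x \<le> 0 \<and> y \<le> 0"

lemma markov_trace_minus: "markov_trace (- x) (- y) = markov_trace x y"
  by (simp add: markov_trace_def)

lemma same_sign_minus: "same_sign (- x) (- y) \<longleftrightarrow> same_sign x y"
  by (auto simp: same_sign_def)

lemma markov_trace_add_nonneg:
  assumes "0 \<le> a" "0 \<le> b" "0 \<le> c" "0 \<le> d" "\<bar>a * d - b * c\<bar> = 1"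
    and "same_sign (a - c) (b - d)"
  shows "markov_trace (a + c) (b + d) + markov_trace (a - c) (b - d)
    = markov_trace a b * markov_trace c d"
proof -
  obtain a' b' c' d' where *: "a = int a'" "b = int b'" "c = int c'" "d = int d'"
    using assms(1-4) zero_le_imp_eq_int by metis
  \<comment> \<open>The forbidden pair of unit vectors has difference (1, -1) up to sign, which the
    last hypothesis rules out.\<close>
  have ne: "{(a', b'), (c', d')} \<noteq> {(1, 0), (0, 1)}"
    using assms(6) unfolding * same_sign_def by (auto simp: doubleton_eq_iff)
  have det: "\<bar>int a' * int d' - int b' * int c'\<bar> = 1"
    using assms(5) unfolding * .
  have n: "nat \<bar>int a' + int c'\<bar> = a' + c'" "nat \<bar>int b' + int d'\<bar> = b' + d'" by linarith+
  show ?thesis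
    unfolding markov_trace_def * n
      is_markov_distance_step[OF is_markov_distance_markov_dist det ne]
    by (simp add: algebra_simps)
qed

text \<open>Lattice form of tr(A B) + tr(A B^-1) = tr A tr B in SL(2). Negating a vector preserves
  traces, and negating just one of the two exchanges sum and difference up to sign, so every case
  moves to the nonnegative quadrant.\<close>

lemma markov_trace_add:
  assumes "same_sign a b" "same_sign c d" "same_sign (a + c) (b + d)" "same_sign (a - c) (b - d)"
    and "\<bar>a * d - b * c\<bar> = 1"
  shows "markov_trace (a + c) (b + d) + markov_trace (a - c) (b - d)
    = markov_trace a b * markov_trace c d"
proof -
  note neg = markov_trace_minus[of "a + c" "b + d"] markov_trace_minus[of "a - c" "b - d"]
    markov_trace_minus[of a b] markov_trace_minus[of c d]
    same_sign_minus[of "a + c" "b + d"] same_sign_minus[of "a - c" "b - d"]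
  consider "0 \<le> a" "0 \<le> b" "0 \<le> c" "0 \<le> d" | "0 \<le> a" "0 \<le> b" "c \<le> 0" "d \<le> 0"
    | "a \<le> 0" "b \<le> 0" "0 \<le> c" "0 \<le> d" | "a \<le> 0" "b \<le> 0" "c \<le> 0" "d \<le> 0"
    using assms(1,2) unfolding same_sign_def by blast
  then show ?thesis
  proof cases
    case 1
    then show ?thesis using markov_trace_add_nonneg[of a b c d] assms by simp
  next
    case 2
    have "\<bar>a * - d - b * - c\<bar> = 1" using assms(5) by (simp add: abs_if split: if_splits)
    then show ?thesis using markov_trace_add_nonneg[of a b "- c" "- d"] assms 2 neg by simp
  next
    case 3
    have "\<bar>- a * d - - b * c\<bar> = 1" using assms(5) by (simp add: abs_if split: if_splits)
    then show ?thesis using markov_trace_add_nonneg[of "- a" "- b" c d] assms 3 neg by simp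
  next
    case 4
    then show ?thesis using markov_trace_add_nonneg[of "- a" "- b" "- c" "- d"] assms neg by simp
  qed
qed

lemma markov_trace_0: "markov_trace 0 0 = 0"
  by (simp add: markov_trace_def is_markov_distance_0[OF is_markov_distance_markov_dist])

lemma markov_trace_mult_Suc_Suc:
  assumes "coprime a b"
  shows "markov_trace (int (Suc (Suc n)) * a) (int (Suc (Suc n)) * b)
    = markov_trace a b * markov_trace (int (Suc n) * a) (int (Suc n) * b)
      - markov_trace (int n * a) (int n * b)"
proof -
  have n: "nat \<bar>int k * z\<bar> = k * nat \<bar>z\<bar>" for k z
    by (simp add: abs_mult nat_mult_distrib)
  have cop: "coprime (nat \<bar>a\<bar>) (nat \<bar>b\<bar>)" using assms by simp
  show ?thesis
    unfolding markov_trace_def n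
    using is_markov_distance_multiple[OF is_markov_distance_markov_dist cop, of "Suc (Suc n)"]
    by (simp del: mult_Suc)
qed

section \<open>Lower bounds for traces of matrix words\<close>

lemma coprime_if_det_1:
  fixes a b c d :: int
  assumes "\<bar>a * d - b * c\<bar> = 1"
  shows "coprime a b"
proof (rule coprimeI)
  fix k assume "k dvd a" "k dvd b"
  then have "k dvd a * d - b * c" by simp
  then have "k dvd \<bar>a * d - b * c\<bar>" by simp
  then show "is_unit k" using assms by simp
qed

text \<open>Growth by the factor \<open>e\<close> is an invariant of the recurrence along a ray: if
  F(n) is at most F(n+1)/e, then F(n+2) is at least (t - 1/e) F(n+1), hence at least e F(n+1). The
  bound e + 1/e is what a nonnegative matrix of determinant 1 with upper left entry \<open>e\<close>
  provides; \<open>e\<close> may be below 1.\<close>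

lemma markov_trace_mult_ge_power:
  assumes "coprime a b" "0 < e" "markov_trace a b \<ge> e + 1 / e"
  shows "markov_trace (int (Suc n) * a) (int (Suc n) * b) \<ge> e ^ Suc n"
proof -
  let ?F = "\<lambda>n. markov_trace (int n * a) (int n * b)"
  have *: "?F (Suc n) \<ge> e * ?F n \<and> ?F n \<ge> 0 \<and> ?F (Suc n) \<ge> e ^ Suc n" for n
  proof (induction n)
    case 0
    have "1 / e > 0" using assms(2) by simp
    then have "markov_trace a b \<ge> e" using assms(3) by linarith
    then show ?case using assms(2) by (simp add: markov_trace_0)
  next
    case (Suc n)
    have "?F (Suc n) \<ge> 0" using Suc assms(2) by (meson mult_nonneg_nonneg less_imp_le order_trans)
    have "?F n \<le> ?F (Suc n) / e" using Suc assms(2) by (simp add: field_simps)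
    then have "?F (Suc (Suc n)) \<ge> (markov_trace a b - 1 / e) * ?F (Suc n)"
      unfolding markov_trace_mult_Suc_Suc[OF assms(1)] by (simp add: algebra_simps)
    moreover have "(markov_trace a b - 1 / e) * ?F (Suc n) \<ge> e * ?F (Suc n)"
      using assms(3) \<open>?F (Suc n) \<ge> 0\<close> by (intro mult_right_mono) simp_all
    ultimately have 1: "?F (Suc (Suc n)) \<ge> e * ?F (Suc n)" by linarith
    have "e * ?F (Suc n) \<ge> e * e ^ Suc n" using Suc assms(2) by (intro mult_left_mono) simp_all
    then show ?case using 1 \<open>?F (Suc n) \<ge> 0\<close> by simp
  qed
  show ?thesis using * by blast
qed

text \<open>A difference of mixed signs makes one product in the determinant exceed the other by at
  least 1 plus two of the coordinates. As the excess is 1, these coordinates vanish and only unit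
  vectors remain.\<close>

lemma det_1_diff_not_same_sign:
  fixes a b c d :: int
  assumes "0 \<le> a" "0 \<le> b" "0 \<le> c" "0 \<le> d" "\<bar>a * d - b * c\<bar> = 1"
    and "\<not> same_sign (a - c) (b - d)"
  shows "a = 0 \<and> b = 1 \<and> c = 1 \<and> d = 0 \<or> a = 1 \<and> b = 0 \<and> c = 0 \<and> d = 1"
proof -
  from assms(6) consider "c \<ge> a + 1" "b \<ge> d + 1" | "a \<ge> c + 1" "d \<ge> b + 1"
    unfolding same_sign_def by linarith
  then show ?thesis
  proof cases
    case 1
    have "(a + 1) * (d + 1) \<le> c * b" using 1 assms by (intro mult_mono) simp_all
    then have "b * c - a * d \<ge> a + d + 1" by (simp add: algebra_simps)
    then have *: "a = 0" "d = 0" using assms by linarith+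
    then have "b * c = 1" using assms 1 by (simp add: abs_mult)
    then show ?thesis using * assms by (auto simp: zmult_eq_1_iff)
  next
    case 2
    have "(c + 1) * (b + 1) \<le> a * d" using 2 assms by (intro mult_mono) simp_all
    then have "a * d - b * c \<ge> b + c + 1" by (simp add: algebra_simps)
    then have *: "b = 0" "c = 0" using assms by linarith+
    then have "a * d = 1" using assms 2 by (simp add: abs_mult)
    then show ?thesis using * assms by (auto simp: zmult_eq_1_iff)
  qed
qed

text \<open>Keeps Euclid's algorithm inside the region where traces are meaningful. The sum leaves
  it only for unit vectors on different axes with opposite signs, and then every positive
  combination leaves it too.\<close>

lemma same_sign_add:
  fixes k l :: nat
  assumes "same_sign a b" "same_sign c d" "\<bar>a * d - b * c\<bar> = 1" "k \<ge> 1" "l \<ge> 1"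
    and "same_sign (int k * a + int l * c) (int k * b + int l * d)"
  shows "same_sign (a + c) (b + d)"
proof -
  have main: "same_sign (a - c) (b - d)"
    if "0 \<le> a" "0 \<le> b" "0 \<le> c" "0 \<le> d" "\<bar>a * d - b * c\<bar> = 1"
      "same_sign (int k * a - int l * c) (int k * b - int l * d)" "k \<ge> 1" "l \<ge> 1"
    for a b c d :: int and k l :: nat
  proof (rule ccontr)
    assume "\<not> ?thesis"
    from det_1_diff_not_same_sign[OF that(1-5) this] that(6-8) show False
      by (auto simp: same_sign_def)
  qed
  consider "0 \<le> a \<and> 0 \<le> b \<and> 0 \<le> c \<and> 0 \<le> d \<or> a \<le> 0 \<and> b \<le> 0 \<and> c \<le> 0 \<and> d \<le> 0"
    | "0 \<le> a" "0 \<le> b" "c \<le> 0" "d \<le> 0" | "a \<le> 0" "b \<le> 0" "0 \<le> c" "0 \<le> d"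
    using assms(1,2) unfolding same_sign_def by blast
  then show ?thesis
  proof cases
    case 1
    then show ?thesis unfolding same_sign_def by auto
  next
    case 2
    have "\<bar>a * - d - b * - c\<bar> = 1" using assms(3) by (simp add: abs_if algebra_simps split: if_splits)
    then show ?thesis using main[of a b "- c" "- d" k l] 2 assms by simp
  next
    case 3
    have "\<bar>c * - b - d * - a\<bar> = 1" using assms(3) by (simp add: abs_if algebra_simps split: if_splits)
    then show ?thesis using main[of c d "- a" "- b" l k] 3 assms by (simp add: add.commute)
  qed
qed

text \<open>
  The matrices $(p, q; r, s)$ and $(p', q'; r', s')$ represent the lattice vectors $(a, b)$ and
  $(c, d)$. The induction is Euclid's algorithm on $(k, l)$, replacing one of the two vectors by
  their sum and its matrix by the product.
\<close>

lemma markov_trace_ge_diagonal: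
  fixes k l :: nat and a b c d :: int and p q r s p' q' r' s' :: real
  assumes "same_sign a b" "same_sign c d" "\<bar>a * d - b * c\<bar> = 1" "k + l \<ge> 1"
    and "same_sign (int k * a + int l * c) (int k * b + int l * d)"
    and "p > 0" "q \<ge> 0" "r \<ge> 0" "s \<ge> 0" "p * s - q * r = 1" "p + s = markov_trace a b"
    and "p' > 0" "q' \<ge> 0" "r' \<ge> 0" "s' \<ge> 0" "p' * s' - q' * r' = 1" "p' + s' = markov_trace c d"
    and "same_sign (a + c) (b + d) \<Longrightarrow>
      p * p' + q * r' + r * q' + s * s' = markov_trace (a + c) (b + d)"
  shows "markov_trace (int k * a + int l * c) (int k * b + int l * d) \<ge> p ^ k * p' ^ l"
  using assms
proof (induction "k + l" arbitrary: k l a b c d p q r s p' q' r' s' rule: less_induct)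
  case less
  note prems = less.prems
  have single: "markov_trace (int n * a) (int n * b) \<ge> p ^ n"
    if "n \<ge> 1" "coprime a b" "p > 0" "q \<ge> 0" "r \<ge> 0" "p * s - q * r = 1" "p + s = markov_trace a b"
    for n a b p q r s
  proof -
    have "s = (1 + q * r) / p" using that by (simp add: field_simps)
    then have "s \<ge> 1 / p" using that by (simp add: divide_right_mono)
    then show ?thesis using markov_trace_mult_ge_power[of a b p "n - 1"] that by simp
  qed
  consider "l = 0" | "k = 0" | "k \<ge> 1" "l \<ge> 1" "l \<le> k" | "k \<ge> 1" "l \<ge> 1" "k < l" by linarith
  then show ?case
  proof cases
    case 1
    then show ?thesis using single[of k a b p q r s] prems coprime_if_det_1[OF prems(3)] by simp
  next
    case 2
    have "\<bar>c * b - d * a\<bar> = 1" using prems(3) by (simp add: abs_if algebra_simps split: if_splits)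
    then show ?thesis using 2 single[of l c d p' q' r' s'] prems coprime_if_det_1[of c b d a] by simp
  next
    case 3
    have V: "same_sign (a + c) (b + d)"
      using same_sign_add prems(1,2,3,5) 3(1,2) by blast
    have X: "int k * a + int l * c = int (k - l) * a + int l * (a + c)"
      "int k * b + int l * d = int (k - l) * b + int l * (b + d)"
      using 3 by (simp_all add: of_nat_diff algebra_simps)
    have det: "\<bar>a * (b + d) - b * (a + c)\<bar> = 1" using prems(3) by (simp add: algebra_simps)
    have tr: "p * p' + q * r' + (r * q' + s * s') = markov_trace (a + c) (b + d)"
      using prems(18)[OF V] by simp
    have dets: "(p * p' + q * r') * (r * q' + s * s') - (p * q' + q * s') * (r * p' + s * r') = 1"
      using prems(10,16) by algebra
    \<comment> \<open>Cayley-Hamilton for the two matrices A and B gives tr(A A B) = tr A tr(A B) -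
      tr B, in agreement with the identity for lattice points. It is claimed only under
      \<open>same_sign\<close>, since elsewhere absolute values do not give the trace of the
      product.\<close>
    have step: "p * (p * p' + q * r') + q * (r * p' + s * r') + r * (p * q' + q * s') + s * (r * q' + s * s')
        = markov_trace (a + (a + c)) (b + (b + d))" if V2: "same_sign (a + (a + c)) (b + (b + d))"
    proof -
      have "markov_trace (a + (a + c)) (b + (b + d)) + markov_trace (a - (a + c)) (b - (b + d))
        = markov_trace a b * markov_trace (a + c) (b + d)"
        using markov_trace_add[OF prems(1) V V2 _ det] prems(2) same_sign_minus[of c d] by simp
      then have "markov_trace (a + (a + c)) (b + (b + d)) =
        (p + s) * (p * p' + q * r' + (r * q' + s * s')) - (p' + s')"
        using markov_trace_minus[of c d] prems(11,17) tr by simp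
      also have "\<dots> = p * (p * p' + q * r') + q * (r * p' + s * r') + r * (p * q' + q * s')
          + s * (r * q' + s * s') + (p * s - q * r - 1) * (p' + s')"
        by (simp add: algebra_simps)
      finally show ?thesis using prems(10) by simp
    qed
    have "p ^ (k - l) * (p * p' + q * r') ^ l
      \<le> markov_trace (int (k - l) * a + int l * (a + c)) (int (k - l) * b + int l * (b + d))"
    proof (rule less.hyps[of "k - l" l a b "a + c" "b + d" p q r s "p * p' + q * r'" "p * q' + q * s'"
          "r * p' + s * r'" "r * q' + s * s'"])
      show "same_sign (int (k - l) * a + int l * (a + c)) (int (k - l) * b + int l * (b + d))"
        using prems(5) X by simp
      show "0 < p * p' + q * r'" using prems by (simp add: add_pos_nonneg)
    qed (use 3 V det tr dets step prems in simp_all)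
    moreover have "p ^ k * p' ^ l = p ^ (k - l) * (p * p') ^ l"
      using 3 by (simp add: power_mult_distrib flip: power_add mult.assoc)
    \<comment> \<open>The upper left entry of a product of nonnegative matrices is at least the
      product of the upper left entries.\<close>
    moreover have "p ^ (k - l) * (p * p') ^ l \<le> p ^ (k - l) * (p * p' + q * r') ^ l"
      using prems by (intro mult_left_mono power_mono) simp_all
    ultimately show ?thesis using X by simp
  next
    case 4
    have V: "same_sign (a + c) (b + d)"
      using same_sign_add prems(1,2,3,5) 4(1,2) by blast
    have X: "int k * a + int l * c = int k * (a + c) + int (l - k) * c"
      "int k * b + int l * d = int k * (b + d) + int (l - k) * d"
      using 4 by (simp_all add: of_nat_diff algebra_simps)
    have det: "\<bar>(a + c) * d - (b + d) * c\<bar> = 1" using prems(3) by (simp add: algebra_simps)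
    have tr: "p * p' + q * r' + (r * q' + s * s') = markov_trace (a + c) (b + d)"
      using prems(18)[OF V] by simp
    have dets: "(p * p' + q * r') * (r * q' + s * s') - (p * q' + q * s') * (r * p' + s * r') = 1"
      using prems(10,16) by algebra
    \<comment> \<open>The mirror identity tr(A B B) = tr(A B) tr B - tr A.\<close>
    have step: "(p * p' + q * r') * p' + (p * q' + q * s') * r' + (r * p' + s * r') * q' + (r * q' + s * s') * s'
        = markov_trace (a + c + c) (b + d + d)" if V2: "same_sign (a + c + c) (b + d + d)"
    proof -
      have "markov_trace (a + c + c) (b + d + d) + markov_trace (a + c - c) (b + d - d)
        = markov_trace (a + c) (b + d) * markov_trace c d"
        using markov_trace_add[OF V prems(2) V2 _ det] prems(1) by simp
      then have "markov_trace (a + c + c) (b + d + d) =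
        (p * p' + q * r' + (r * q' + s * s')) * (p' + s') - (p + s)"
        using prems(11,17) tr by simp
      also have "\<dots> = (p * p' + q * r') * p' + (p * q' + q * s') * r' + (r * p' + s * r') * q'
          + (r * q' + s * s') * s' + (p' * s' - q' * r' - 1) * (p + s)"
        by (simp add: algebra_simps)
      finally show ?thesis using prems(16) by simp
    qed
    have "(p * p' + q * r') ^ k * p' ^ (l - k)
      \<le> markov_trace (int k * (a + c) + int (l - k) * c) (int k * (b + d) + int (l - k) * d)"
    proof (rule less.hyps[of k "l - k" "a + c" "b + d" c d "p * p' + q * r'" "p * q' + q * s'"
          "r * p' + s * r'" "r * q' + s * s'" p' q' r' s'])
      show "same_sign (int k * (a + c) + int (l - k) * c) (int k * (b + d) + int (l - k) * d)"
        using prems(5) X by simp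
      show "0 < p * p' + q * r'" using prems by (simp add: add_pos_nonneg)
    qed (use 4 V det tr dets step prems in simp_all)
    moreover have "p ^ k * p' ^ l = (p * p') ^ k * p' ^ (l - k)"
      using 4 by (simp add: power_mult_distrib mult.assoc flip: power_add)
    moreover have "(p * p') ^ k * p' ^ (l - k) \<le> (p * p' + q * r') ^ k * p' ^ (l - k)"
      using prems by (intro mult_right_mono power_mono) simp_all
    ultimately show ?thesis using X by simp
  qed
qed

section \<open>The Markov equation\<close>

text \<open>Descent by subtracting one vector from the other ends at the unit vectors, where the
  traces 3, 3, 6 satisfy 9 + 9 + 36 = 54. Passing from Markov numbers to traces absorbs the usual
  factor 3.\<close>

lemma markov_equation:
  fixes a b c d :: int
  assumes "0 \<le> a" "0 \<le> b" "0 \<le> c" "0 \<le> d" "\<bar>a * d - b * c\<bar> = 1"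
  shows "markov_trace a b > 0 \<and> markov_trace c d > 0 \<and> markov_trace (a + c) (b + d) > 0
    \<and> (markov_trace a b)\<^sup>2 + (markov_trace c d)\<^sup>2 + (markov_trace (a + c) (b + d))\<^sup>2
      = markov_trace a b * markov_trace c d * markov_trace (a + c) (b + d)"
  using assms
proof (induction "nat (a + b + c + d)" arbitrary: a b c d rule: less_induct)
  case less
  have init: "markov_trace 1 0 = 3" "markov_trace 0 1 = 3" "markov_trace 1 1 = 6"
    using is_markov_distance_markov_dist by (simp_all add: markov_trace_def is_markov_distance_def)
  \<comment> \<open>Vieta jumping: for fixed \<open>u\<close> and \<open>v\<close>, both
    \<open>w\<close> and \<open>X\<close> are roots of z^2 - u v z + u^2 + v^2. The product of the
    roots is positive, so positivity passes from \<open>w\<close> to \<open>X\<close>.\<close>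
  have main: ?case if eq: "X = u * v - w" and w: "w > 0 \<and> v > 0 \<and> u > 0 \<and> w\<^sup>2 + v\<^sup>2 + u\<^sup>2 = w * v * u"
      and r: "markov_trace (a + c) (b + d) = X" "markov_trace a b = u" "markov_trace c d = v"
    for X u v w
  proof -
    have "w\<^sup>2 + v\<^sup>2 + u\<^sup>2 = w * v * u" using w by blast
    with eq have "X * w = u\<^sup>2 + v\<^sup>2" by algebra
    moreover have "u\<^sup>2 + v\<^sup>2 > 0" using w by (simp add: add_pos_pos)
    ultimately have "X > 0" using w by (metis zero_less_mult_pos2)
    moreover have "u\<^sup>2 + v\<^sup>2 + X\<^sup>2 = u * v * X"
      using eq \<open>X * w = u\<^sup>2 + v\<^sup>2\<close> by algebra
    ultimately show ?thesis using w r by simp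
  qed
  consider "\<not> same_sign (a - c) (b - d)" | "a \<ge> c" "b \<ge> d" | "a \<le> c" "b \<le> d"
    unfolding same_sign_def by linarith
  then show ?case
  proof cases
    case 1
    from det_1_diff_not_same_sign[OF less.prems 1] show ?thesis by (auto simp: init)
  next
    case 2
    \<comment> \<open>The determinant keeps (c, d) from vanishing, so the coordinate sum really
      drops.\<close>
    have "c > 0 \<or> d > 0" using less.prems by (metis abs_0 diff_self mult_zero_right order_le_less zero_neq_one)
    then have "c + d > 0 \<and> a + b + c + d > 0" using less.prems by linarith
    moreover have det: "\<bar>(a - c) * d - (b - d) * c\<bar> = 1" using less.prems by (simp add: algebra_simps)
    ultimately have "markov_trace (a - c) (b - d) > 0 \<and> markov_trace c d > 0 \<and> markov_trace a b > 0
      \<and> (markov_trace (a - c) (b - d))\<^sup>2 + (markov_trace c d)\<^sup>2 + (markov_trace a b)\<^sup>2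
      = markov_trace (a - c) (b - d) * markov_trace c d * markov_trace a b"
      using less.hyps[of "a - c" "b - d" c d] less.prems 2 by simp
    moreover have "markov_trace (a + c) (b + d) + markov_trace (a - c) (b - d)
      = markov_trace a b * markov_trace c d"
      using less.prems 2 by (intro markov_trace_add_nonneg) (simp_all add: same_sign_def)
    ultimately show ?thesis by (intro main[where w = "markov_trace (a - c) (b - d)", OF _ _ refl refl refl]) simp_all
  next
    case 3
    have "a > 0 \<or> b > 0" using less.prems by (metis abs_0 diff_self mult_zero_left order_le_less zero_neq_one)
    then have "a + b > 0 \<and> a + b + c + d > 0" using less.prems by linarith
    moreover have det: "\<bar>a * (d - b) - b * (c - a)\<bar> = 1" using less.prems by (simp add: algebra_simps)
    ultimately have "markov_trace a b > 0 \<and> markov_trace (c - a) (d - b) > 0 \<and> markov_trace c d > 0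
      \<and> (markov_trace a b)\<^sup>2 + (markov_trace (c - a) (d - b))\<^sup>2 + (markov_trace c d)\<^sup>2
      = markov_trace a b * markov_trace (c - a) (d - b) * markov_trace c d"
      using less.hyps[of a b "c - a" "d - b"] less.prems 3 by simp
    moreover have "markov_trace (a + c) (b + d) + markov_trace (a - c) (b - d)
      = markov_trace a b * markov_trace c d"
      using less.prems 3 by (intro markov_trace_add_nonneg) (simp_all add: same_sign_def)
    ultimately show ?thesis using markov_trace_minus[of "a - c" "b - d"]
      by (intro main[where w = "markov_trace (c - a) (d - b)", OF _ _ refl refl refl])
        (simp_all add: algebra_simps)
  qed
qed

section \<open>Eigenvalues and exponential lower bounds\<close>

text \<open>Binet formula: the recurrence along a ray has characteristic roots \<theta> and
  1/\<theta>. Multiplying by their difference clears the denominator.\<close>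

lemma markov_trace_mult_eq:
  assumes "coprime a b" "\<theta> > 1" "\<theta> + 1 / \<theta> = markov_trace a b"
  shows "markov_trace (int n * a) (int n * b) * (\<theta> - 1 / \<theta>)
    = markov_trace a b * (\<theta> ^ n - (1 / \<theta>) ^ n)"
proof (induction n rule: induct_nat_012)
  case 0
  then show ?case by (simp add: markov_trace_0)
next
  case 1
  then show ?case by simp
next
  case (ge2 n)
  let ?t = "markov_trace a b" and ?\<mu> = "1 / \<theta>"
  have "markov_trace (int (Suc (Suc n)) * a) (int (Suc (Suc n)) * b) * (\<theta> - ?\<mu>)
    = ?t * (markov_trace (int (Suc n) * a) (int (Suc n) * b) * (\<theta> - ?\<mu>))
      - markov_trace (int n * a) (int n * b) * (\<theta> - ?\<mu>)"
    unfolding markov_trace_mult_Suc_Suc[OF assms(1)] by (simp add: algebra_simps)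
  also have "\<dots> = ?t * ((\<theta> + ?\<mu>) * (\<theta> ^ Suc n - ?\<mu> ^ Suc n) - (\<theta> ^ n - ?\<mu> ^ n))"
    unfolding ge2 assms(3) by (simp add: algebra_simps)
  also have "(\<theta> + ?\<mu>) * (\<theta> ^ Suc n - ?\<mu> ^ Suc n) - (\<theta> ^ n - ?\<mu> ^ n)
    = \<theta> ^ Suc (Suc n) - ?\<mu> ^ Suc (Suc n) + (\<theta> * ?\<mu> - 1) * (\<theta> ^ n - ?\<mu> ^ n)"
    by (simp only: power_Suc) (simp add: algebra_simps del: times_divide_eq_right times_divide_eq_left)
  finally show ?case using assms(2) by simp
qed

text \<open>
  For \<open>u\<close>, \<open>w\<close> and \<open>t\<close> the traces at $U$, $W$ and $Q = U + W$, the trace at $U + nQ$ is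
  $\alpha \theta^n + \alpha' \theta^{-n-1}$; the cases $n = 0$ and $n = -1$ determine the coefficients.
\<close>

lemma asymptotic_coefficients:
  fixes \<theta> u w t :: real
  assumes "\<theta> > 1" "t = \<theta> + 1 / \<theta>" "u > 0" "w > 0" "u\<^sup>2 + w\<^sup>2 + t\<^sup>2 = u * w * t"
    and \<alpha>: "\<alpha> = (\<theta> * u - w) / (\<theta> - 1 / \<theta>)" and \<alpha>': "\<alpha>' = (\<theta> * w - u) / (\<theta> - 1 / \<theta>)"
  shows "\<alpha> + \<alpha>' / \<theta> = u" "\<alpha> / \<theta> + \<alpha>' = w" "\<alpha> * \<alpha>' * (\<theta> - 1 / \<theta>)\<^sup>2 = \<theta> * t\<^sup>2"
    "\<alpha> > 0" "\<alpha>' > 0" "\<alpha> * \<alpha>' > \<theta>"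
proof -
  define \<mu> where "\<mu> = 1 / \<theta>"
  have lm: "\<theta> * \<mu> = 1" using assms(1) by (simp add: \<mu>_def)
  have "1 / \<theta> < 1" using assms(1) by simp
  then have "1 / \<theta> < \<theta>" using assms(1) by linarith
  then have \<mu>: "0 < \<mu>" "\<mu> < \<theta>" using assms(1) unfolding \<mu>_def by auto
  have e: "\<alpha> * (\<theta> - \<mu>) = \<theta> * u - w" "\<alpha>' * (\<theta> - \<mu>) = \<theta> * w - u"
    using \<mu> by (simp_all add: \<alpha> \<alpha>' flip: \<mu>_def)
  have "(\<alpha> + \<alpha>' * \<mu>) * (\<theta> - \<mu>) = u * (\<theta> - \<mu>)" using e lm by algebra
  then have 1: "\<alpha> + \<alpha>' * \<mu> = u" using \<mu> by simp
  have "(\<alpha> * \<mu> + \<alpha>') * (\<theta> - \<mu>) = w * (\<theta> - \<mu>)" using e lm by algebra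
  then have 2: "\<alpha> * \<mu> + \<alpha>' = w" using \<mu> by simp
  have t: "t = \<theta> + \<mu>" using assms(2) by (simp add: \<mu>_def)
  have "\<alpha> * \<alpha>' * (\<theta> - \<mu>)\<^sup>2 = (\<theta> * u - w) * (\<theta> * w - u)"
    unfolding e[symmetric] by (simp add: power2_eq_square)
  also have "\<dots> = \<theta> * (u * w * t - u\<^sup>2 - w\<^sup>2)" using lm unfolding t by algebra
  also have "\<dots> = \<theta> * t\<^sup>2" using assms(5) by algebra
  finally have 3: "\<alpha> * \<alpha>' * (\<theta> - \<mu>)\<^sup>2 = \<theta> * t\<^sup>2" .
  have "t\<^sup>2 = (\<theta> - \<mu>)\<^sup>2 + 4" using lm unfolding t by algebra
  \<comment> \<open>Because t^2 exceeds (\<theta> - \<mu>)^2 by 4, the product formula turns into a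
    strict bound. It later makes an off-diagonal matrix entry nonnegative and lets a base above 1 be
    raised to a power.\<close>
  then have "\<theta> * (\<theta> - \<mu>)\<^sup>2 < \<alpha> * \<alpha>' * (\<theta> - \<mu>)\<^sup>2" using 3 assms(1) by simp
  then show 6: "\<alpha> * \<alpha>' > \<theta>" using \<mu> by (simp add: mult_less_cancel_right)
  \<comment> \<open>The positive product gives both coefficients the same sign; the positive value
    \<open>u\<close> of \<alpha> + \<alpha>' \<mu> decides which.\<close>
  have "\<not> (\<alpha> \<le> 0 \<and> \<alpha>' \<le> 0)"
    using 1 assms(3) \<mu> by (metis add_nonpos_nonpos linorder_not_less mult_nonpos_nonneg less_imp_le)
  moreover have "\<alpha> * \<alpha>' > 0" using 6 assms(1) by linarith
  ultimately show "\<alpha> > 0" "\<alpha>' > 0" by (auto simp: zero_less_mult_iff)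
  show "\<alpha> + \<alpha>' / \<theta> = u" "\<alpha> / \<theta> + \<alpha>' = w" "\<alpha> * \<alpha>' * (\<theta> - 1 / \<theta>)\<^sup>2 = \<theta> * t\<^sup>2"
    using 1 2 3 by (simp_all add: \<mu>_def)
qed

text \<open>In the eigenbasis, Q is diag(\<theta>, 1/\<theta>) and U has rows (\<alpha>, r) and (1,
  \<alpha>'/\<theta>): scaling makes the lower left entry 1, and determinant 1 forces the value of
  \<open>r\<close>. For nonnegative \<open>j\<close> the point is a word in U and Q. For negative
  \<open>j\<close> it is a word in U and -W = U - Q, whose matrix is U Q^-1.\<close>

lemma markov_trace_support:
  fixes a b c d j :: int and k :: nat
  assumes pos: "0 \<le> a" "0 \<le> b" "0 \<le> c" "0 \<le> d" and det: "\<bar>a * d - b * c\<bar> = 1"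
    and l: "\<theta> > 1" "\<theta> + 1 / \<theta> = markov_trace (a + c) (b + d)"
    and \<alpha>: "\<alpha> = (\<theta> * markov_trace a b - markov_trace c d) / (\<theta> - 1 / \<theta>)"
    and k: "k \<ge> 1" and X: "0 \<le> int k * a + j * (a + c)" "0 \<le> int k * b + j * (b + d)"
  shows "markov_trace (int k * a + j * (a + c)) (int k * b + j * (b + d)) \<ge> \<alpha> ^ k * \<theta> powi j"
proof -
  define u w t where "u = markov_trace a b" and "w = markov_trace c d" and "t = markov_trace (a + c) (b + d)"
  define \<alpha>' where "\<alpha>' = (\<theta> * w - u) / (\<theta> - 1 / \<theta>)"
  have "u > 0" "w > 0" "u\<^sup>2 + w\<^sup>2 + t\<^sup>2 = u * w * t"
    using markov_equation[OF pos det] by (simp_all add: u_def w_def t_def)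
  note co = asymptotic_coefficients[OF l(1) _ this \<alpha>[folded u_def w_def] \<alpha>'_def]
  have lt: "t = \<theta> + 1 / \<theta>" using l(2) by (simp add: t_def)
  note co = co[OF lt]
  define r where "r = \<alpha> * \<alpha>' / \<theta> - 1"
  have r: "r \<ge> 0" using co l by (simp add: r_def field_simps)
  have V: "same_sign a b" "same_sign c d" "same_sign (a + c) (b + d)"
    using pos by (auto simp: same_sign_def)
  show ?thesis
  proof (cases "j \<ge> 0")
    case True
    then obtain n where j: "j = int n" using zero_le_imp_eq_int by blast
    have "markov_trace (int k * a + int n * (a + c)) (int k * b + int n * (b + d)) \<ge> \<alpha> ^ k * \<theta> ^ n"
    proof (rule markov_trace_ge_diagonal[of a b "a + c" "b + d" k n \<alpha> r 1 "\<alpha>' / \<theta>" \<theta> 0 0 "1 / \<theta>"])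
      show "\<bar>a * (b + d) - b * (a + c)\<bar> = 1" using det by (simp add: algebra_simps)
      show "same_sign (int k * a + int n * (a + c)) (int k * b + int n * (b + d))"
        using X j by (simp add: same_sign_def)
      show "\<alpha> * \<theta> + r * 0 + 1 * 0 + \<alpha>' / \<theta> * (1 / \<theta>) = markov_trace (a + (a + c)) (b + (b + d))"
      proof -
        have "markov_trace (a + (a + c)) (b + (b + d)) + markov_trace (a - (a + c)) (b - (b + d)) = u * t"
          unfolding u_def t_def using V pos det same_sign_minus[of c d]
          by (intro markov_trace_add) (auto simp: algebra_simps same_sign_def)
        then have "markov_trace (a + (a + c)) (b + (b + d)) = u * t - w"
          using markov_trace_minus[of c d] by (simp add: w_def)
        also have "\<dots> = \<alpha> * \<theta> + \<alpha>' / \<theta> * (1 / \<theta>)"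
          unfolding lt co(1,2)[symmetric] using l(1) by (simp add: field_simps)
        finally show ?thesis by simp
      qed
    qed (use V k co r l in \<open>auto simp: r_def u_def t_def less_imp_le\<close>)
    then show ?thesis by (simp add: j)
  next
    case False
    define n where "n = nat (- j)"
    have j: "j = - int n" using False by (simp add: n_def)
    \<comment> \<open>The point equals (k - n) U - n W. With n > k it could lie in the quadrant only
      if W were zero, against the determinant.\<close>
    have "n \<le> k"
    proof (rule ccontr)
      assume "\<not> n \<le> k"
      have "int k * a + j * (a + c) = - (int n - int k) * a - int n * c"
        "int k * b + j * (b + d) = - (int n - int k) * b - int n * d"
        by (simp_all add: j algebra_simps)
      moreover have "(int n - int k) * a \<ge> 0" "(int n - int k) * b \<ge> 0" "int n * c \<ge> 0" "int n * d \<ge> 0"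
        using \<open>\<not> n \<le> k\<close> pos by simp_all
      ultimately have "int n * c \<le> 0 \<and> int n * d \<le> 0" using X by linarith
      then have "c = 0" "d = 0" using \<open>\<not> n \<le> k\<close> pos by (auto simp: mult_le_0_iff)
      then show False using det by simp
    qed
    then have X': "int k * a + j * (a + c) = int (k - n) * a + int n * - c"
      "int k * b + j * (b + d) = int (k - n) * b + int n * - d"
      by (simp_all add: j of_nat_diff algebra_simps)
    have "markov_trace (int (k - n) * a + int n * - c) (int (k - n) * b + int n * - d)
      \<ge> \<alpha> ^ (k - n) * (\<alpha> / \<theta>) ^ n"
    proof (rule markov_trace_ge_diagonal[of a b "- c" "- d" "k - n" n \<alpha> r 1 "\<alpha>' / \<theta>"
          "\<alpha> / \<theta>" "r * \<theta>" "1 / \<theta>" \<alpha>'])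
      show "\<bar>a * - d - b * - c\<bar> = 1" using det by (simp add: abs_if algebra_simps split: if_splits)
      show "same_sign (int (k - n) * a + int n * - c) (int (k - n) * b + int n * - d)"
        using X X' by (simp add: same_sign_def)
      show "\<alpha> * (\<alpha> / \<theta>) + r * (1 / \<theta>) + 1 * (r * \<theta>) + \<alpha>' / \<theta> * \<alpha>' = markov_trace (a + - c) (b + - d)"
        if "same_sign (a + - c) (b + - d)"
      proof -
        have "markov_trace (a + c) (b + d) + markov_trace (a - c) (b - d) = u * w"
          unfolding u_def w_def using V that det by (intro markov_trace_add) simp_all
        then have "markov_trace (a - c) (b - d) = u * w - t" by (simp add: t_def)
        also have "\<dots> = \<alpha> * (\<alpha> / \<theta>) + r * (1 / \<theta>) + 1 * (r * \<theta>) + \<alpha>' / \<theta> * \<alpha>'"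
          unfolding lt r_def co(1,2)[symmetric] using l(1) by (simp add: field_simps)
        finally show ?thesis by simp
      qed
      show "\<alpha> / \<theta> * \<alpha>' - r * \<theta> * (1 / \<theta>) = 1" using l(1) by (simp add: r_def)
      show "\<alpha> / \<theta> + \<alpha>' = markov_trace (- c) (- d)" using co by (simp add: markov_trace_minus w_def)
      show "same_sign (- c) (- d)" using V by (simp add: same_sign_minus)
    qed (use V k co r l \<open>n \<le> k\<close> in \<open>auto simp: r_def u_def less_imp_le\<close>)
    also have "\<alpha> ^ (k - n) * (\<alpha> / \<theta>) ^ n = \<alpha> ^ k * \<theta> powi j"
      using \<open>n \<le> k\<close> by (simp add: j power_int_minus power_divide divide_inverse[symmetric] flip: power_add)
    finally show ?thesis using X' by simp
  qed
qed

section \<open>Convexity across and along a ray\<close>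

text \<open>Traces are three times integers. This gap lifts positive traces above 2, as
  \<open>obtain_eigenvalue\<close> requires.\<close>

lemma markov_trace_ge_3:
  assumes "markov_trace x y > 0"
  shows "markov_trace x y \<ge> 3"
  using assms by (simp add: markov_trace_def)

lemma obtain_eigenvalue:
  fixes t :: real
  assumes "t > 2"
  obtains \<theta> where "\<theta> > 1" "\<theta> + 1 / \<theta> = t"
proof
  have *: "t\<^sup>2 > 2\<^sup>2" using assms by (intro power_strict_mono) simp_all
  define \<theta> where "\<theta> = (t + sqrt (t\<^sup>2 - 4)) / 2"
  have "sqrt (t\<^sup>2 - 4) \<ge> 0" using * by simp
  then have "t + sqrt (t\<^sup>2 - 4) > 2" using assms by linarith
  then show l: "\<theta> > 1" by (simp add: \<theta>_def)
  have "2 * \<theta> - t = sqrt (t\<^sup>2 - 4)" by (simp add: \<theta>_def field_simps)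
  then have "(2 * \<theta> - t)\<^sup>2 = t\<^sup>2 - 4" using * by simp
  then have "\<theta> * \<theta> + 1 = t * \<theta>" by (simp add: power2_eq_square algebra_simps)
  then show "\<theta> + 1 / \<theta> = t" using l by (simp add: field_simps)
qed

lemma markov_trace_convex_transversal:
  fixes a b c d j x y x'' y'' :: int and h k :: nat
  assumes pos: "0 \<le> a" "0 \<le> b" "0 \<le> c" "0 \<le> d" and det: "\<bar>a * d - b * c\<bar> = 1"
    and k: "k \<ge> 1" and A: "x = int k * a + j * (a + c)" "y = int k * b + j * (b + d)"
    and C: "x + x'' = 2 * (int h * (a + c))" "y + y'' = 2 * (int h * (b + d))"
    and nonneg: "0 \<le> x" "0 \<le> y" "0 \<le> x''" "0 \<le> y''"
  shows "markov_trace x y + markov_trace x'' y'' \<ge> 2 * markov_trace (int h * (a + c)) (int h * (b + d))"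
proof -
  define u w t where "u = markov_trace a b" and "w = markov_trace c d" and "t = markov_trace (a + c) (b + d)"
  have eqn: "u > 0" "w > 0" "t > 0" "u\<^sup>2 + w\<^sup>2 + t\<^sup>2 = u * w * t"
    using markov_equation[OF pos det] by (simp_all add: u_def w_def t_def)
  then have "t > 2" using markov_trace_ge_3[of "a + c" "b + d"] by (simp add: t_def)
  then obtain \<theta> where l: "\<theta> > 1" "\<theta> + 1 / \<theta> = t" by (rule obtain_eigenvalue)
  define \<mu> where "\<mu> = 1 / \<theta>"
  define \<alpha> \<alpha>' where "\<alpha> = (\<theta> * u - w) / (\<theta> - 1 / \<theta>)" and "\<alpha>' = (\<theta> * w - u) / (\<theta> - 1 / \<theta>)"
  note co = asymptotic_coefficients[OF l(1) l(2)[symmetric] eqn(1,2,4) \<alpha>_def \<alpha>'_def]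
  \<comment> \<open>Since U = Q - W, reflecting k U + j Q in h Q gives k W + (2h - k - j) Q.\<close>
  define i where "i = 2 * int h - int k - j"
  have C': "x'' = int k * c + i * (c + a)" "y'' = int k * d + i * (d + b)"
    using A C by (simp_all add: i_def algebra_simps)
  have det': "\<bar>c * b - d * a\<bar> = 1" using det by (simp add: abs_if algebra_simps split: if_splits)
  define M where "M = markov_trace (int h * (a + c)) (int h * (b + d))"
  have 1: "markov_trace x y \<ge> \<alpha> ^ k * \<theta> powi j"
    using markov_trace_support[OF pos det l(1) _ _ k] l(2) A nonneg
    by (simp add: t_def u_def w_def \<alpha>_def)
  have 2: "markov_trace x'' y'' \<ge> \<alpha>' ^ k * \<theta> powi i"
    unfolding C'
    using markov_trace_support[OF pos(3,4,1,2) det' l(1) _ _ k] l(2) C' nonneg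
    by (simp add: t_def u_def w_def \<alpha>'_def add.commute)
  have \<mu>: "0 < \<mu>" "\<mu> < 1" using l(1) by (simp_all add: \<mu>_def)
  then have "\<mu> < \<theta>" using l(1) by linarith
  note \<mu> = \<mu> this
  have "(\<theta> - \<mu>)\<^sup>2 > 0" using \<mu> by simp
  have cop: "coprime (a + c) (b + d)"
    by (rule coprime_if_det_1[of _ d _ c]) (use det in \<open>simp add: algebra_simps\<close>)
  have "M * (\<theta> - \<mu>) = t * (\<theta> ^ h - \<mu> ^ h)"
    using markov_trace_mult_eq[OF cop l(1), of h] l(2) by (simp add: M_def t_def \<mu>_def)
  then have "(M * (\<theta> - \<mu>))\<^sup>2 = t\<^sup>2 * (\<theta> ^ h - \<mu> ^ h)\<^sup>2" by (simp add: power_mult_distrib)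
  \<comment> \<open>Only the dominant power in the closed form of \<open>M\<close> is kept. The
    square of its coefficient t/(\<theta> - \<mu>) is exactly \<alpha> \<alpha>'/\<theta>.\<close>
  also have "\<dots> \<le> t\<^sup>2 * (\<theta> ^ h)\<^sup>2"
    using \<mu> l by (intro mult_left_mono power_mono) (simp_all add: power_mono less_imp_le)
  finally have "M\<^sup>2 * (\<theta> - \<mu>)\<^sup>2 \<le> t\<^sup>2 * (\<theta> ^ h)\<^sup>2" by (simp add: power_mult_distrib)
  also have "\<dots> = \<alpha> * \<alpha>' / \<theta> * (\<theta> ^ h)\<^sup>2 * (\<theta> - \<mu>)\<^sup>2"
    using co(3) l(1) by (simp add: \<mu>_def field_simps)
  finally have "M\<^sup>2 \<le> \<alpha> * \<alpha>' / \<theta> * (\<theta> ^ h)\<^sup>2"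
    using \<open>(\<theta> - \<mu>)\<^sup>2 > 0\<close> by (metis mult_le_cancel_right_pos)
  \<comment> \<open>The base \<alpha> \<alpha>'/\<theta> exceeds 1, so its k-th power is no
    smaller.\<close>
  also have "\<dots> \<le> (\<alpha> * \<alpha>' / \<theta>) ^ k * (\<theta> ^ h)\<^sup>2"
    using k co(6) l(1) by (intro mult_right_mono self_le_power) (simp_all add: field_simps)
  also have "\<dots> = (\<alpha> ^ k * \<theta> powi j) * (\<alpha>' ^ k * \<theta> powi i)"
  proof -
    \<comment> \<open>The exponents add up to 2h - k; the missing k powers of \<theta> are the
      denominators in (\<alpha> \<alpha>'/\<theta>)^k.\<close>
    have "\<theta> powi j * \<theta> powi i = \<theta> powi (2 * int h - int k)"
      using l(1) by (simp add: i_def flip: power_int_add)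
    also have "\<dots> = \<theta> powi (int (2 * h)) / \<theta> powi (int k)"
      using l(1) by (subst power_int_diff[symmetric]) simp_all
    also have "\<dots> = (\<theta> ^ h)\<^sup>2 / \<theta> ^ k"
      by (simp only: power_int_of_nat) (simp add: power_mult[symmetric] mult.commute)
    finally have "(\<alpha> ^ k * \<theta> powi j) * (\<alpha>' ^ k * \<theta> powi i) = \<alpha> ^ k * \<alpha>' ^ k * ((\<theta> ^ h)\<^sup>2 / \<theta> ^ k)"
      by (metis mult.assoc mult.left_commute)
    then show ?thesis by (simp add: power_mult_distrib power_divide)
  qed
  also have "\<dots> \<le> markov_trace x y * markov_trace x'' y''"
    using 1 2 co l(1) by (intro mult_mono) (auto intro: order_trans[OF _ 1] simp: less_imp_le)
  finally have 3: "M\<^sup>2 \<le> markov_trace x y * markov_trace x'' y''" .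
  have "(2 * M)\<^sup>2 \<le> (markov_trace x y + markov_trace x'' y'')\<^sup>2"
    using 3 zero_le_power2[of "markov_trace x y - markov_trace x'' y''"]
    by (simp add: power2_eq_square algebra_simps)
  moreover have "\<alpha> ^ k * \<theta> powi j \<ge> 0" "\<alpha>' ^ k * \<theta> powi i \<ge> 0" using co l(1) by simp_all
  then have "markov_trace x y + markov_trace x'' y'' \<ge> 0" using 1 2 by linarith
  ultimately show ?thesis unfolding M_def by (rule power2_le_imp_le)
qed

lemma markov_trace_convex_multiples:
  assumes cop: "coprime a b" and t: "markov_trace a b > 0" and ij: "i + j = 2 * h"
  shows "markov_trace (int i * a) (int i * b) + markov_trace (int j * a) (int j * b)
    \<ge> 2 * markov_trace (int h * a) (int h * b)"
proof -
  have "markov_trace a b > 2" using markov_trace_ge_3[OF t] by simp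
  then obtain \<theta> where l: "\<theta> > 1" "\<theta> + 1 / \<theta> = markov_trace a b" by (rule obtain_eigenvalue)
  define \<mu> where "\<mu> = 1 / \<theta>"
  have \<mu>: "0 < \<mu>" "\<mu> < 1" "\<theta> * \<mu> = 1" using l(1) by (simp_all add: \<mu>_def)
  then have "\<mu> < \<theta>" using l(1) by linarith
  note \<mu> = \<mu>(1,2) this \<mu>(3)
  \<comment> \<open>For \<theta> = exp s this is sinh((h+d)s) + sinh((h-d)s) = 2 sinh(hs) cosh(ds)
    together with cosh(ds) at least 1.\<close>
  have main: "2 * (\<theta> ^ h - \<mu> ^ h) \<le> (\<theta> ^ (h + d) - \<mu> ^ (h + d)) + (\<theta> ^ (h - d) - \<mu> ^ (h - d))"
    if "d \<le> h" for d
  proof -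
    have 1: "\<theta> ^ d * \<mu> ^ d = 1" using \<mu>(4) by (simp flip: power_mult_distrib)
    have e: "\<theta> ^ h = \<theta> ^ (h - d) * \<theta> ^ d" "\<mu> ^ h = \<mu> ^ (h - d) * \<mu> ^ d"
      using that by (simp_all flip: power_add)
    have "\<theta> ^ h * \<mu> ^ d = \<theta> ^ (h - d) * (\<theta> ^ d * \<mu> ^ d)" "\<mu> ^ h * \<theta> ^ d = \<mu> ^ (h - d) * (\<theta> ^ d * \<mu> ^ d)"
      unfolding e by (simp_all only: mult.assoc mult.commute mult.left_commute)
    then have "\<theta> ^ h * \<mu> ^ d = \<theta> ^ (h - d)" "\<mu> ^ h * \<theta> ^ d = \<mu> ^ (h - d)"
      unfolding 1 by simp_all
    then have "(\<theta> ^ (h + d) - \<mu> ^ (h + d)) + (\<theta> ^ (h - d) - \<mu> ^ (h - d))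
      = (\<theta> ^ h - \<mu> ^ h) * (\<theta> ^ d + \<mu> ^ d)"
      by (simp add: power_add algebra_simps)
    moreover have "\<theta> ^ d + \<mu> ^ d \<ge> 2"
    proof -
      have "(\<theta> ^ d + \<mu> ^ d)\<^sup>2 \<ge> 2\<^sup>2"
        using 1 zero_le_power2[of "\<theta> ^ d - \<mu> ^ d"] by (simp add: power2_eq_square algebra_simps)
      then show ?thesis using l(1) \<mu>(1) by (intro power2_le_imp_le[of 2]) simp_all
    qed
    moreover have "\<theta> ^ h - \<mu> ^ h \<ge> 0" using \<mu> by (simp add: power_mono)
    ultimately show ?thesis using mult_left_mono[of 2 "\<theta> ^ d + \<mu> ^ d" "\<theta> ^ h - \<mu> ^ h"] by simp
  qed
  have "2 * (\<theta> ^ h - \<mu> ^ h) \<le> (\<theta> ^ i - \<mu> ^ i) + (\<theta> ^ j - \<mu> ^ j)"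
  proof (cases "i \<ge> h")
    case True
    then have "h + (i - h) = i" "h - (i - h) = j" "i - h \<le> h" using ij by linarith+
    then show ?thesis using main[of "i - h"] by simp
  next
    case False
    then have "h + (j - h) = j" "h - (j - h) = i" "j - h \<le> h" using ij by linarith+
    then show ?thesis using main[of "j - h"] by simp
  qed
  then have "markov_trace a b * (2 * (\<theta> ^ h - \<mu> ^ h))
    \<le> markov_trace a b * ((\<theta> ^ i - \<mu> ^ i) + (\<theta> ^ j - \<mu> ^ j))"
    using t by (intro mult_left_mono) simp_all
  then have "(2 * markov_trace (int h * a) (int h * b)) * (\<theta> - \<mu>)
    \<le> (markov_trace (int i * a) (int i * b) + markov_trace (int j * a) (int j * b)) * (\<theta> - \<mu>)"
    unfolding distrib_right mult.assoc
    by (simp only: markov_trace_mult_eq[OF cop l, folded \<mu>_def] mult.left_commute[of 2] distrib_left)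
  then show ?thesis using \<mu>(3) by (simp add: mult_le_cancel_right)
qed

section \<open>Reduction to Farey coordinates\<close>

text \<open>Off the axes, positivity comes with the Markov equation at a Farey decomposition; on the
  axes it is an initial value.\<close>

lemma markov_trace_pos:
  assumes "coprime q p"
  shows "markov_trace (int q) (int p) > 0"
proof (cases "q \<ge> 1 \<and> p \<ge> 1")
  case True
  then obtain a b c d where *: "q = a + c" "p = b + d" "a * d = b * c + 1"
    using farey_parents_exist[OF assms] by blast
  have "int a * int d - int b * int c = 1" using arg_cong[OF *(3), of int] by simp
  then show ?thesis using markov_equation[of "int a" "int b" "int c" "int d"] * by simp
next
  case False
  then have "q = 0 \<and> p = 1 \<or> q = 1 \<and> p = 0" using assms by (cases "q = 0"; cases "p = 0") auto
  then show ?thesis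
    using is_markov_distance_markov_dist by (auto simp: markov_trace_def is_markov_distance_def)
qed

theorem proposition1p3:
  fixes x y x' y' x'' y'' :: nat
  assumes "x \<ge> y" and "x' \<ge> y'" and "x'' \<ge> y''"
    and "real x' = (real x + real x'') / 2" and "real y' = (real y + real y'') / 2"
  shows "markov_dist x y + markov_dist x'' y'' \<ge> 2 * markov_dist x' y'"
proof -
  have sum: "x + x'' = 2 * x'" "y + y'' = 2 * y'" using assms(4,5) by (simp_all add: field_simps flip: of_nat_add)
  have "2 * markov_trace (int x') (int y') \<le> markov_trace (int x) (int y) + markov_trace (int x'') (int y'')"
  proof (cases "x' = 0")
    \<comment> \<open>The midpoint is now the origin because y' is at most x', and so are both outer
      points.\<close>
    case True
    then show ?thesis using sum assms(2) by simp
  next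
    case False
    define h q p where "h = gcd x' y'" and "q = x' div h" and "p = y' div h"
    have B: "x' = h * q" "y' = h * p" by (simp_all add: h_def q_def p_def)
    have cop: "coprime q p" using False unfolding h_def q_def p_def
      by (intro div_gcd_coprime) simp
    have q: "q \<ge> 1" using False B by (cases q) auto
    \<comment> \<open>The determinant of (x, y) and Q vanishes when the points are collinear with
      the origin. Otherwise its sign tells the side of the line through Q, positive on the side of
      U.\<close>
    define D where "D = int x * int p - int y * int q"
    have D'': "int x'' * int p - int y'' * int q = - D"
    proof -
      have "int x + int x'' = 2 * (int h * int q)" "int y + int y'' = 2 * (int h * int p)"
        using sum B by (simp_all flip: of_nat_add of_nat_mult)
      then show ?thesis unfolding D_def by algebra
    qed
    show ?thesis
    proof (cases "D = 0")
      case True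
      have mult: "\<exists>i. z = i * q \<and> z' = i * p" if "int z * int p - int z' * int q = 0" for z z'
      proof -
        have e: "z * p = z' * q" using that by (simp flip: of_nat_mult)
        then have "q dvd z" using cop by (metis coprime_dvd_mult_left_iff dvd_triv_right)
        then obtain i where "z = i * q" by (metis dvd_div_mult_self)
        then show ?thesis using e q by auto
      qed
      obtain i where i: "x = i * q" "y = i * p" using mult[of x y] True by (auto simp: D_def)
      obtain j where j: "x'' = j * q" "y'' = j * p" using mult[of x'' y''] True D'' by auto
      have "(i + j) * q = 2 * h * q" using i j B sum by (simp add: algebra_simps)
      then have "i + j = 2 * h" using q by simp
      moreover have "coprime (int q) (int p)" using cop by simp
      ultimately show ?thesis
        using markov_trace_convex_multiples[OF _ markov_trace_pos[OF cop]] i j B by simp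
    next
      case False
      \<comment> \<open>A midpoint on the horizontal axis would put the outer points there too and
        make \<open>D\<close> zero. Hence Q has positive coordinates and a Farey
        decomposition.\<close>
      have "p \<ge> 1"
      proof (rule ccontr)
        assume "\<not> p \<ge> 1"
        then have "p = 0" by simp
        then show False using False B sum by (simp add: D_def)
      qed
      then obtain a b c d where *: "q = a + c" "p = b + d" "a * d = b * c + 1"
        using farey_parents_exist[OF cop q] by blast
      have det: "int a * int d - int b * int c = 1" using arg_cong[OF *(3), of int] by simp
      have main: "2 * markov_trace (int x') (int y') \<le> markov_trace (int z) (int v) + markov_trace (int z'') (int v'')"
        if D: "int z * int p - int v * int q > 0" and s: "z + z'' = 2 * x'" "v + v'' = 2 * y'" for z v z'' v''
      proof -
        \<comment> \<open>Cramer's rule: the coordinates of (z, v) in the basis U, Q of determinant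
          1.\<close>
        define k j where "k = nat (int z * int p - int v * int q)"
          and "j = int a * int v - int b * int z"
        have k: "int k = int z * int p - int v * int q" using D by (simp add: k_def)
        have kj: "int k * int a + j * (int a + int c) = int z" "int k * int b + j * (int b + int d) = int v"
          using det unfolding k j_def * of_nat_add by algebra+
        have s': "int z + int z'' = 2 * (int h * (int a + int c))" "int v + int v'' = 2 * (int h * (int b + int d))"
          using s B * by (simp_all flip: of_nat_add of_nat_mult)
        have "k \<ge> 1" using D k by linarith
        from markov_trace_convex_transversal[OF _ _ _ _ _ this kj[symmetric] s'] det
        show ?thesis using B * by simp
      qed
      show ?thesis
      proof (cases "D > 0")
        case True
        then show ?thesis using main[of x y x'' y''] sum by (simp add: D_def)
      next
        case F: False
        \<comment> \<open>The other outer point has determinant -D > 0, so the two exchange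
          roles.\<close>
        then show ?thesis using main[of x'' y'' x y] sum D'' False by (simp add: add.commute)
      qed
    qed
  qed
  then have "real_of_int (2 * markov_dist x' y') \<le> real_of_int (markov_dist x y + markov_dist x'' y'')"
    by (simp add: markov_trace_def)
  then show ?thesis by (simp only: of_int_le_iff)
qed

end
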